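(* For every integer $n\ge1$, the expectation of the number $C_n$ of comparisons in the dual-pivot Quicksort algorithm is $$E[C_n]=2(n+1)H_1(n)-4n.$$
   Context: $H_1(n)=\sum_{i=1}^n\frac1i$. Dual-pivot Quicksort on a list of $n\ge2$ distinct elements: two pivots are chosen uniformly at random and sorted using one comparison, say $p_1<p_2$; every other element is first compared with $p_1$, and if it is larger than $p_1$ it is also compared with $p_2$; this splits the non-pivot elements into those smaller than $p_1$, those between $p_1$ and $p_2$, and those larger than $p_2$, and the algorithm is applied recursively to the three sublists. Lists of length at most $1$ need no comparisons. $C_n$ is the total number of comparisons. Formally, its probability generating function $P_n(t)$ is determined by $P_0(t)=P_1(t)=1$, $P_2(t)=t$ and, for $n\ge3$, $P_n(t)=\frac1{\binom n2}\sum_{j=2}^n\sum_{i=1}^{j-1}P_{i-1}(t)P_{j-i-1}(t)P_{n-j}(t)\,t^{2n-i-2}$. *)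

theory Defs
  imports "HOL-Probability.Probability" "HOL-Library.Monad_Syntax"
begin

text \<open>
  The last component counts comparisons: one (with \<^term>\<open>p1\<close>) for an element smaller than
  \<^term>\<open>p1\<close>, and two (with \<^term>\<open>p1\<close>, then with \<^term>\<open>p2\<close>) for any other element.
\<close>
fun dual_pivot_partition :: "'a::linorder \<Rightarrow> 'a \<Rightarrow> 'a list \<Rightarrow> 'a list \<times> 'a list \<times> 'a list \<times> nat"
where
  "dual_pivot_partition p1 p2 [] = ([], [], [], 0)"
| "dual_pivot_partition p1 p2 (x # xs) =
     (case dual_pivot_partition p1 p2 xs of (ls, ms, rs, c) \<Rightarrow>
        if x < p1 then (x # ls, ms, rs, c + 1)
        else if x < p2 then (ls, x # ms, rs, c + 2)
        else (ls, ms, x # rs, c + 2))"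

lemma length_dual_pivot_partition:
  "dual_pivot_partition p1 p2 xs = (ls, ms, rs, c) \<Longrightarrow>
     length ls + length ms + length rs = length xs"
  by (induction xs arbitrary: ls ms rs c) (auto split: prod.splits if_splits)

definition pivot_positions :: "nat \<Rightarrow> (nat \<times> nat) set" where
  "pivot_positions n = {(i, j). i < n \<and> j < n \<and> i \<noteq> j}"

lemma finite_pivot_positions [simp]: "finite (pivot_positions n)"
  by (rule finite_subset[of _ "{..<n} \<times> {..<n}"]) (auto simp: pivot_positions_def)

lemma pivot_positions_nonempty: "n \<ge> 2 \<Longrightarrow> pivot_positions n \<noteq> {}"
proof -
  assume "n \<ge> 2"
  then have "(0, 1) \<in> pivot_positions n" by (simp add: pivot_positions_def)
  then show ?thesis by blast
qed

lemma length_nths_pivot_positions: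
  assumes "(i, j) \<in> pivot_positions (length xs)"
  shows "length (nths xs (- {i, j})) + 2 = length xs"
proof -
  have "{k. k < length xs \<and> k \<in> - {i, j}} = {..<length xs} - {i, j}" by auto
  moreover have "card ({..<length xs} - {i, j}) = length xs - 2"
    using assms by (subst card_Diff_subset) (auto simp: pivot_positions_def)
  moreover have "length xs \<ge> 2"
    using assms by (auto simp: pivot_positions_def)
  ultimately show ?thesis by (simp add: length_nths)
qed

text \<open>
  The result is the joint distribution of the sorted list and the total number of comparisons.
  The two pivots are found at a uniformly random ordered pair of distinct positions; the summand
  \<^term>\<open>1 :: nat\<close> is the comparison that puts them in order.
\<close>
function dual_pivot_quicksort :: "'a::linorder list \<Rightarrow> ('a list \<times> nat) pmf" where
  "dual_pivot_quicksort xs =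
     (if length xs \<le> 1 then return_pmf (xs, 0)
      else do {
        (i, j) \<leftarrow> pmf_of_set (pivot_positions (length xs));
        let (p1, p2) = (if xs ! i < xs ! j then (xs ! i, xs ! j) else (xs ! j, xs ! i));
        let (ls, ms, rs, c) = dual_pivot_partition p1 p2 (nths xs (- {i, j}));
        (ls', c1) \<leftarrow> dual_pivot_quicksort ls;
        (ms', c2) \<leftarrow> dual_pivot_quicksort ms;
        (rs', c3) \<leftarrow> dual_pivot_quicksort rs;
        return_pmf (ls' @ [p1] @ ms' @ [p2] @ rs', 1 + c + c1 + c2 + c3)
      })"
  by pat_completeness auto
termination
proof (relation "Wellfounded.measure length", goal_cases)
  case 1
  show ?case by simp
qed (force simp: pivot_positions_nonempty
       dest!: length_dual_pivot_partition[OF sym] length_nths_pivot_positions)+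

declare dual_pivot_quicksort.simps [simp del]

definition dual_pivot_comparisons :: "'a::linorder list \<Rightarrow> nat pmf" where
  "dual_pivot_comparisons xs = map_pmf snd (dual_pivot_quicksort xs)"

lemma finite_set_pmf_dual_pivot_quicksort [simp]: "finite (set_pmf (dual_pivot_quicksort xs))"
proof (induction xs rule: length_induct)
  case (1 xs)
  note IH = 1[rule_format]
  show ?case
  proof (cases "length xs \<le> 1")
    case True
    then show ?thesis by (simp add: dual_pivot_quicksort.simps[of xs])
  next
    case False
    have *: "finite (set_pmf (dual_pivot_quicksort ls)) \<and> finite (set_pmf (dual_pivot_quicksort ms)) \<and>
        finite (set_pmf (dual_pivot_quicksort rs))"
      if "(i, j) \<in> pivot_positions (length xs)"
        "dual_pivot_partition p1 p2 (nths xs (- {i, j})) = (ls, ms, rs, c)" for i j p1 p2 ls ms rs c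
      using length_nths_pivot_positions[OF that(1)] length_dual_pivot_partition[OF that(2)]
      by (intro conjI IH) linarith+
    have "pivot_positions (length xs) \<noteq> {}"
      using False by (intro pivot_positions_nonempty) auto
    then show ?thesis
      using False by (subst dual_pivot_quicksort.simps) (auto simp: Let_def * split: prod.splits)
  qed
qed

lemma finite_set_pmf_dual_pivot_comparisons [simp]:
  "finite (set_pmf (dual_pivot_comparisons xs))"
  by (simp add: dual_pivot_comparisons_def)

lemma dual_pivot_partition_eq:
  assumes "p1 < p2"
  shows "dual_pivot_partition p1 p2 xs =
     (filter (\<lambda>x. x < p1) xs, filter (\<lambda>x. p1 \<le> x \<and> x < p2) xs, filter (\<lambda>x. p2 \<le> x) xs,
      length xs + length (filter (\<lambda>x. p1 \<le> x) xs))"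
  using assms by (induction xs) (auto simp: not_less)

lemma expectation_step:
  fixes t K :: real
  assumes fin: "finite (set_pmf A)" "\<And>r. r \<in> set_pmf A \<Longrightarrow> finite (set_pmf (f r))"
    and eq: "\<And>r. r \<in> set_pmf A \<Longrightarrow> measure_pmf.expectation (f r) (\<lambda>r. t ^ snd r) = t ^ snd r * K"
  shows "measure_pmf.expectation (A \<bind> f) (\<lambda>r. t ^ snd r) =
           measure_pmf.expectation A (\<lambda>r. t ^ snd r) * K"
proof -
  have "measure_pmf.expectation (A \<bind> f) (\<lambda>r. t ^ snd r) =
      (\<Sum>a\<in>set_pmf A. pmf A a *\<^sub>R measure_pmf.expectation (f a) (\<lambda>r. t ^ snd r))"
    using fin by (intro pmf_expectation_bind) auto
  also have "\<dots> = (\<Sum>a\<in>set_pmf A. pmf A a *\<^sub>R t ^ snd a) * K"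
    by (simp add: eq sum_distrib_right mult.assoc)
  also have "(\<Sum>a\<in>set_pmf A. pmf A a *\<^sub>R t ^ snd a) = measure_pmf.expectation A (\<lambda>r. t ^ snd r)"
    using fin by (intro integral_measure_pmf[symmetric]) auto
  finally show ?thesis .
qed

lemma expectation_combine:
  fixes t :: real
  assumes [simp]: "finite (set_pmf A)" "finite (set_pmf B)" "finite (set_pmf C)"
  shows "measure_pmf.expectation
     (do {(x, a) \<leftarrow> A; (y, b) \<leftarrow> B; (z, c) \<leftarrow> C; return_pmf (h x y z, k + a + b + c)})
     (\<lambda>r. t ^ snd r) =
     measure_pmf.expectation A (\<lambda>r. t ^ snd r) * (measure_pmf.expectation B (\<lambda>r. t ^ snd r)
      * (measure_pmf.expectation C (\<lambda>r. t ^ snd r) * t ^ k))"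
proof -
  have C: "measure_pmf.expectation (do {(z, c) \<leftarrow> C; return_pmf (g z, m + c)}) (\<lambda>r. t ^ snd r) =
      measure_pmf.expectation C (\<lambda>r. t ^ snd r) * t ^ m" for g :: "'c \<Rightarrow> 'd" and m
    by (rule expectation_step) (auto simp: power_add)
  have B: "measure_pmf.expectation
      (do {(y, b) \<leftarrow> B; (z, c) \<leftarrow> C; return_pmf (g y z, m + b + c)}) (\<lambda>r. t ^ snd r) =
      measure_pmf.expectation B (\<lambda>r. t ^ snd r) *
        (measure_pmf.expectation C (\<lambda>r. t ^ snd r) * t ^ m)" for g :: "'b \<Rightarrow> 'c \<Rightarrow> 'd" and m
    by (rule expectation_step) (auto simp: C power_add split: prod.splits)
  show ?thesis
    by (rule expectation_step) (auto simp: B power_add split: prod.splits)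
qed

lemma length_filter_distinct: "distinct xs \<Longrightarrow> length (filter P xs) = card {x \<in> set xs. P x}"
  by (metis distinct_card distinct_filter set_filter)

text \<open>
  For distinct keys the distribution of the number of comparisons depends only on the length of
  the list, and its probability generating function satisfies the usual recurrence. In the double
  sum, \<^term>\<open>i < j\<close> are the ranks of the two pivots.
\<close>
theorem dual_pivot_comparisons_pgf:
  fixes t :: real and P :: "nat \<Rightarrow> real" and xs :: "'a::linorder list"
  assumes P0: "P 0 = 1" and P1: "P 1 = 1" and P2: "P 2 = t"
    and P: "\<And>n. n \<ge> 3 \<Longrightarrow> P n = 1 / real (n choose 2) *
             (\<Sum>j=2..n. \<Sum>i=1..j - 1. P (i - 1) * P (j - i - 1) * P (n - j) * t ^ (2 * n - i - 2))"
    and "distinct xs"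
  shows "measure_pmf.expectation (dual_pivot_comparisons xs) (\<lambda>c. t ^ c) = P (length xs)"
proof -
  define E where "E xs = measure_pmf.expectation (dual_pivot_quicksort xs) (\<lambda>r. t ^ snd r)"
    for xs :: "'a list"
  have Pn: "P n = 1 / real (n choose 2) *
             (\<Sum>j=2..n. \<Sum>i=1..j - 1. P (i - 1) * P (j - i - 1) * P (n - j) * t ^ (2 * n - i - 2))"
    if "n \<ge> 2" for n
  proof (cases "n = 2")
    case True
    then show ?thesis using P0 P2 by simp
  qed (use that P in auto)
  have "E xs = P (length xs)"
    using \<open>distinct xs\<close>
  proof (induction xs rule: length_induct)
    case (1 xs)
    note IH = 1(1)[rule_format] and dist = \<open>distinct xs\<close>
    define n where "n = length xs"
    show ?case
    proof (cases "n \<le> 1")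
      case True
      then have "n = 0 \<or> n = 1" by auto
      then show ?thesis
        using P0 P1 True by (auto simp: E_def dual_pivot_quicksort.simps[of xs] n_def)
    next
      case False
      define rk where "rk y = card {x \<in> set xs. x < y}" for y
      define G where "G u v = P u * (P (v - u - 1) * (P (n - v - 1) * t ^ (2 * n - u - 3)))" for u v
      have rk_mono: "rk x < rk y" if "x < y" "x \<in> set xs" for x y
        unfolding rk_def using that by (intro psubset_card_mono) auto
      have card_set: "card (set xs) = n" using dist by (simp add: distinct_card n_def)
      have rk_less: "rk x < n" if "x \<in> set xs" for x
        unfolding rk_def card_set[symmetric] using that by (intro psubset_card_mono) auto
      define f where "f = (\<lambda>(i, j). do {
        let (p1, p2) = (if xs ! i < xs ! j then (xs ! i, xs ! j) else (xs ! j, xs ! i));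
        let (ls, ms, rs, c) = dual_pivot_partition p1 p2 (nths xs (- {i, j}));
        (ls', c1) \<leftarrow> dual_pivot_quicksort ls;
        (ms', c2) \<leftarrow> dual_pivot_quicksort ms;
        (rs', c3) \<leftarrow> dual_pivot_quicksort rs;
        return_pmf (ls' @ [p1] @ ms' @ [p2] @ rs', 1 + c + c1 + c2 + c3)
      })"
      have f: "finite (set_pmf (f (i, j)))"
        "measure_pmf.expectation (f (i, j)) (\<lambda>r. t ^ snd r) =
            G (min (rk (xs ! i)) (rk (xs ! j))) (max (rk (xs ! i)) (rk (xs ! j)))"
        if ij: "(i, j) \<in> pivot_positions n" for i j
      proof -
        define p where "p = min (xs ! i) (xs ! j)"
        define q where "q = max (xs ! i) (xs ! j)"
        have neq: "xs ! i \<noteq> xs ! j" and lt: "i < n" "j < n"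
          using ij dist by (auto simp: pivot_positions_def n_def nth_eq_iff_index_eq)
        have pq: "p < q" using neq by (auto simp: p_def q_def min_def max_def)
        have pq_set: "p \<in> set xs" "q \<in> set xs"
          using lt by (auto simp: p_def q_def min_def max_def n_def)
        have if_eq: "(if xs ! i < xs ! j then (xs ! i, xs ! j) else (xs ! j, xs ! i)) = (p, q)"
          using neq by (auto simp: p_def q_def min_def max_def)
        define ys where "ys = nths xs (- {i, j})"
        have ys_dist: "distinct ys" by (simp add: ys_def dist)
        have ys_len: "length ys + 2 = n"
          using length_nths_pivot_positions ij by (auto simp: ys_def n_def)
        have ys_set: "set ys = set xs - {p, q}"
        proof -
          have "set ys = (!) xs ` ({..<n} - {i, j})" by (auto simp: ys_def set_nths n_def)
          also have "\<dots> = (!) xs ` {..<n} - (!) xs ` {i, j}"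
            using lt dist by (intro inj_on_image_set_diff[of _ "{..<n}"])
              (auto simp: n_def inj_on_nth)
          also have "(!) xs ` {..<n} = set xs" by (auto simp: n_def set_conv_nth)
          also have "(!) xs ` {i, j} = {p, q}"
            by (auto simp: p_def q_def min_def max_def)
          finally show ?thesis .
        qed
        define ls where "ls = filter (\<lambda>x. x < p) ys"
        define ms where "ms = filter (\<lambda>x. p \<le> x \<and> x < q) ys"
        define rs where "rs = filter (\<lambda>x. q \<le> x) ys"
        define c where "c = length ys + length (filter (\<lambda>x. p \<le> x) ys)"
        have part: "dual_pivot_partition p q ys = (ls, ms, rs, c)"
          using pq by (simp add: dual_pivot_partition_eq ls_def ms_def rs_def c_def)
        have f_eq: "f (i, j) = do {
          (ls', c1) \<leftarrow> dual_pivot_quicksort ls;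
          (ms', c2) \<leftarrow> dual_pivot_quicksort ms;
          (rs', c3) \<leftarrow> dual_pivot_quicksort rs;
          return_pmf (ls' @ [p] @ ms' @ [q] @ rs', 1 + c + c1 + c2 + c3)}"
          by (simp add: f_def if_eq part flip: ys_def)
        show "finite (set_pmf (f (i, j)))" by (auto simp: f_eq)
        have len_ls: "length ls = rk p"
        proof -
          have "{x \<in> set ys. x < p} = {x \<in> set xs. x < p}" using pq by (auto simp: ys_set)
          then show ?thesis by (simp add: ls_def length_filter_distinct ys_dist rk_def)
        qed
        have len_lms: "length ls + length ms + 1 = rk q"
        proof -
          have "{x \<in> set xs. x < q} = insert p ({x \<in> set ys. x < p} \<union> {x \<in> set ys. p \<le> x \<and> x < q})"
            using pq pq_set by (auto simp: ys_set)
          also have "card \<dots> = Suc (card ({x \<in> set ys. x < p} \<union> {x \<in> set ys. p \<le> x \<and> x < q}))"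
            by (subst card_insert_disjoint) (auto simp: ys_set)
          also have "card ({x \<in> set ys. x < p} \<union> {x \<in> set ys. p \<le> x \<and> x < q}) =
              card {x \<in> set ys. x < p} + card {x \<in> set ys. p \<le> x \<and> x < q}"
            by (intro card_Un_disjoint) auto
          finally show ?thesis
            by (simp add: ls_def ms_def length_filter_distinct ys_dist rk_def)
        qed
        have len: "length ls + length ms + length rs = length ys"
          using length_dual_pivot_partition[OF part] .
        have c: "1 + c = 2 * n - rk p - 3"
        proof -
          have "length (filter (\<lambda>x. p \<le> x) ys) + length ls = length ys"
            using sum_length_filter_compl[of "\<lambda>x. x < p" ys] by (simp add: ls_def not_less)
          then show ?thesis using ys_len len_ls by (simp add: c_def)
        qed
        have rk_pq: "rk p = min (rk (xs ! i)) (rk (xs ! j))" "rk q = max (rk (xs ! i)) (rk (xs ! j))"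
        proof -
          have "mono rk" by (intro monoI) (auto simp: rk_def intro!: card_mono)
          then show "rk p = min (rk (xs ! i)) (rk (xs ! j))" "rk q = max (rk (xs ! i)) (rk (xs ! j))"
            by (simp_all add: p_def q_def min_of_mono max_of_mono)
        qed
        have "measure_pmf.expectation (f (i, j)) (\<lambda>r. t ^ snd r) =
            E ls * (E ms * (E rs * t ^ (1 + c)))"
          unfolding f_eq E_def by (rule expectation_combine) auto
        also have "E ls = P (length ls)"
          using IH[of ls] len ys_len dist ys_dist by (auto simp: ls_def n_def)
        also have "E ms = P (length ms)"
          using IH[of ms] len ys_len dist ys_dist by (auto simp: ms_def n_def)
        also have "E rs = P (length rs)"
          using IH[of rs] len ys_len dist ys_dist by (auto simp: rs_def n_def)
        also have "P (length ls) * (P (length ms) * (P (length rs) * t ^ (1 + c))) = G (rk p) (rk q)"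
        proof -
          have "length ls = rk p" "length ms = rk q - rk p - 1" "length rs = n - rk q - 1"
            using len_ls len_lms len ys_len by linarith+
          then show ?thesis unfolding G_def c by simp
        qed
        finally show "measure_pmf.expectation (f (i, j)) (\<lambda>r. t ^ snd r) =
            G (min (rk (xs ! i)) (rk (xs ! j))) (max (rk (xs ! i)) (rk (xs ! j)))"
          by (simp add: rk_pq)
      qed
      have ne: "pivot_positions n \<noteq> {}" using False by (intro pivot_positions_nonempty) auto
      define R where "R i = rk (xs ! i)" for i
      have inj: "inj_on R {..<n}"
      proof (rule inj_onI)
        fix i j assume *: "i \<in> {..<n}" "j \<in> {..<n}" "R i = R j"
        then have "xs ! i = xs ! j"
          using rk_mono[of "xs ! i" "xs ! j"] rk_mono[of "xs ! j" "xs ! i"]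
          by (cases "xs ! i" "xs ! j" rule: linorder_cases) (auto simp: R_def n_def)
        then show "i = j" using * dist by (auto simp: n_def nth_eq_iff_index_eq)
      qed
      have img: "R ` {..<n} = {..<n}"
      proof (rule card_subset_eq)
        show "R ` {..<n} \<subseteq> {..<n}" by (auto simp: R_def n_def intro!: rk_less[unfolded n_def])
        show "card (R ` {..<n}) = card {..<n}" using inj by (rule card_image)
      qed simp
      have bij: "bij_betw (map_prod R R) (pivot_positions n) (pivot_positions n)"
      proof -
        have pp: "pivot_positions n = {..<n} \<times> {..<n} - Id" by (auto simp: pivot_positions_def)
        have inj2: "inj_on (map_prod R R) (pivot_positions n)"
          unfolding pp by (rule inj_on_subset[OF map_prod_inj_on[OF inj inj]]) auto
        moreover have "map_prod R R ` pivot_positions n \<subseteq> pivot_positions n"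
          using img inj by (auto simp: pivot_positions_def inj_on_def)
        ultimately show ?thesis
          by (simp add: bij_betw_def endo_inj_surj)
      qed
      have card_pp: "card (pivot_positions n) = n * (n - 1)"
      proof -
        have "pivot_positions n = (SIGMA i:{..<n}. {..<n} - {i})" by (auto simp: pivot_positions_def)
        then show ?thesis by simp
      qed
      have "E xs = measure_pmf.expectation (pmf_of_set (pivot_positions n) \<bind> f) (\<lambda>r. t ^ snd r)"
        using False unfolding E_def f_def by (subst dual_pivot_quicksort.simps) (simp add: n_def)
      also have "\<dots> = (\<Sum>a\<in>pivot_positions n. measure_pmf.expectation (f a) (\<lambda>r. t ^ snd r) /\<^sub>R
          real (card (pivot_positions n)))"
        using ne f by (intro pmf_expectation_bind_pmf_of_set) auto
      also have "\<dots> = (\<Sum>(i, j)\<in>pivot_positions n. G (min (R i) (R j)) (max (R i) (R j))) / real (n * (n - 1))"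
        unfolding sum_divide_distrib card_pp
        by (intro sum.cong) (auto simp: f R_def divide_inverse_commute)
      also have "(\<Sum>(i, j)\<in>pivot_positions n. G (min (R i) (R j)) (max (R i) (R j))) =
          (\<Sum>(u, v)\<in>pivot_positions n. G (min u v) (max u v))"
        using sum.reindex_bij_betw[OF bij, of "\<lambda>(u, v). G (min u v) (max u v)"]
        by (simp add: case_prod_unfold)
      also have "\<dots> = 2 * (\<Sum>(v, u)\<in>(SIGMA v:{..<n}. {..<v}). G u v)"
      proof -
        let ?A = "SIGMA v:{..<n}. {..<v}"
        have un: "pivot_positions n = ?A \<union> prod.swap ` ?A"
          by (force simp: pivot_positions_def image_iff)
        have "(\<Sum>(u, v)\<in>pivot_positions n. G (min u v) (max u v)) =
            (\<Sum>(u, v)\<in>?A. G (min u v) (max u v)) + (\<Sum>(u, v)\<in>prod.swap ` ?A. G (min u v) (max u v))"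
          unfolding un by (intro sum.union_disjoint) auto
        also have "(\<Sum>(u, v)\<in>prod.swap ` ?A. G (min u v) (max u v)) =
            (\<Sum>(u, v)\<in>?A. G (min u v) (max u v))"
          by (subst sum.reindex) (auto simp: case_prod_unfold min.commute max.commute)
        also have "(\<Sum>(u, v)\<in>?A. G (min u v) (max u v)) = (\<Sum>(v, u)\<in>?A. G u v)"
          by (intro sum.cong) auto
        finally show ?thesis by simp
      qed
      also have "(\<Sum>(v, u)\<in>(SIGMA v:{..<n}. {..<v}). G u v) = (\<Sum>v<n. \<Sum>u<v. G u v)"
        by (simp add: sum.Sigma)
      also have "\<dots> = (\<Sum>v=1..<n. \<Sum>u<v. G u v)"
        by (intro sum.mono_neutral_right) (auto simp: not_less_eq_eq)
      also have "\<dots> = (\<Sum>j=2..n. \<Sum>i=1..j - 1. G (i - 1) (j - 1))"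
      proof (rule sum.reindex_bij_witness[of _ "\<lambda>j. j - 1" Suc])
        fix v assume "v \<in> {1..<n}"
        show "(\<Sum>i = 1..Suc v - 1. G (i - 1) (Suc v - 1)) = (\<Sum>u<v. G u v)"
          by (rule sum.reindex_bij_witness[of _ Suc "\<lambda>j. j - 1"]) auto
      qed auto
      also have "\<dots> = (\<Sum>j=2..n. \<Sum>i=1..j - 1. P (i - 1) * P (j - i - 1) * P (n - j) * t ^ (2 * n - i - 2))"
      proof (intro sum.cong refl)
        fix i j assume "j \<in> {2..n}" "i \<in> {1..j - 1}"
        then have "j - 1 - (i - 1) - 1 = j - i - 1" "n - (j - 1) - 1 = n - j"
          "2 * n - (i - 1) - 3 = 2 * n - i - 2" by auto
        then show "G (i - 1) (j - 1) =
            P (i - 1) * P (j - i - 1) * P (n - j) * t ^ (2 * n - i - 2)"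
          unfolding G_def by (simp add: mult.assoc)
      qed
      also have "2 * \<dots> / real (n * (n - 1)) = P n"
      proof -
        have "2 * (n choose 2) = n * (n - 1)"
          unfolding choose_two by (rule dvd_mult_div_cancel) (cases n; simp)
        then have "real (n * (n - 1)) = 2 * real (n choose 2)" by (metis of_nat_mult of_nat_numeral)
        then show ?thesis using Pn[of n] False by simp
      qed
      finally show ?thesis by (simp add: n_def)
    qed
  qed
  then show ?thesis by (simp add: dual_pivot_comparisons_def E_def)
qed

end

theory Submission
  imports Defs
begin

text \<open>
  The expectation of a random variable with values in the natural numbers is the derivative of its
  probability generating function at \<open>1\<close>, so the recurrence for the generating functions of the
  comparison count turns, by the product rule, into one for its means. All the generating functions
  take the value \<open>1\<close> at \<open>1\<close>, hence differentiating a product of them with a power of \<open>t\<close> just adds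
  the three derivatives and the exponent.

  By symmetry the three sublists contribute equally: each of them has length \<open>k\<close> for exactly
  \<open>n - 1 - k\<close> of the pairs of pivot ranks (\<open>sum_rank_pairs_left\<close>, \<open>sum_rank_pairs_middle\<close> and
  \<open>sum_rank_pairs_right\<close>). The smaller pivot has average rank \<open>(n + 1) / 3\<close>, so one partitioning
  round costs \<open>2 n - 2 - (n + 1) / 3 = (5 n - 7) / 3\<close> comparisons on average. The means \<open>a n\<close>
  therefore satisfy, for \<open>n \<ge> 2\<close>,
  \<open>a n = (5 n - 7) / 3 + 6 / (n (n - 1)) * (\<Sum>k<n. (n - 1 - k) * a k)\<close>,
  and the closed form is verified to be the solution by summing it twice
  (\<open>sum_dual_pivot_mean\<close>, \<open>weighted_sum_dual_pivot_mean\<close>).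
\<close>

text \<open>
  The number of pairs of pivot ranks \<open>i < j\<close> with \<open>i - 1 = k\<close> is \<open>n - 1 - k\<close>. The weight is a
  real difference; at \<open>n = 0\<close>, where it would be negative, the sum is empty.
\<close>
lemma sum_rank_pairs_left:
  fixes f :: "nat \<Rightarrow> real"
  shows "(\<Sum>j=2..n. \<Sum>i=1..j-1. f (i - 1)) = (\<Sum>k<n. (real n - 1 - real k) * f k)"
proof (induction n)
  case (Suc n)
  have shift: "(\<Sum>i=1..n. f (i - 1)) = (\<Sum>k<n. f k)"
    by (rule sum.reindex_bij_witness[of _ Suc "\<lambda>i. i - 1"]) auto
  have "(\<Sum>j=2..Suc n. \<Sum>i=1..j-1. f (i - 1)) =
      (\<Sum>j=2..n. \<Sum>i=1..j-1. f (i - 1)) + (\<Sum>i=1..n. f (i - 1))"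
    by (cases "n = 0") auto
  also have "\<dots> = (\<Sum>k<n. (real n - 1 - real k) * f k + f k)"
    by (simp only: Suc.IH shift sum.distrib)
  also have "\<dots> = (\<Sum>k<Suc n. (real (Suc n) - 1 - real k) * f k)"
    by (simp add: algebra_simps)
  finally show ?case .
qed simp

text \<open>For a fixed larger rank \<open>j\<close>, the reflection \<open>i \<mapsto> j - i\<close> exchanges the left and the middle part.\<close>
lemma sum_rank_pairs_middle:
  fixes f :: "nat \<Rightarrow> real"
  shows "(\<Sum>j=2..n. \<Sum>i=1..j-1. f (j - i - 1)) = (\<Sum>k<n. (real n - 1 - real k) * f k)"
proof -
  have "(\<Sum>i=1..j-1. f (j - i - 1)) = (\<Sum>i=1..j-1. f (i - 1))" for j
    by (rule sum.reindex_bij_witness[of _ "\<lambda>i. j - i" "\<lambda>i. j - i"]) auto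
  then show ?thesis by (simp only: sum_rank_pairs_left)
qed

text \<open>
  There are \<open>j - 1\<close> choices for the smaller rank, and \<open>j - 1 = n - 1 - k\<close> when the right part has
  length \<open>k = n - j\<close>.
\<close>
lemma sum_rank_pairs_right:
  fixes f :: "nat \<Rightarrow> real"
  shows "(\<Sum>j=2..n. \<Sum>i=1..j-1. f (n - j)) = (\<Sum>k<n. (real n - 1 - real k) * f k)"
proof -
  have "(\<Sum>j=2..n. \<Sum>i=1..j-1. f (n - j)) = (\<Sum>j=2..n. (real j - 1) * f (n - j))"
    by (intro sum.cong) (auto simp: of_nat_diff)
  also have "\<dots> = (\<Sum>j=1..n. (real j - 1) * f (n - j))"
    by (intro sum.mono_neutral_left) (auto simp: not_le dest: less_2_cases)
  also have "\<dots> = (\<Sum>k<n. (real n - 1 - real k) * f k)"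
    by (rule sum.reindex_bij_witness[of _ "\<lambda>k. n - k" "\<lambda>j. n - j"]) (auto simp: of_nat_diff)
  finally show ?thesis .
qed

text \<open>
  The total cost of the partitioning round over all pairs of pivot ranks, for an arbitrary
  constant \<open>c\<close> in place of \<open>2 n - 2\<close> so that \<open>n\<close> can vary in the induction.
\<close>
lemma sum_rank_pairs_cost:
  fixes c :: real
  shows "(\<Sum>j=2..n. \<Sum>i=1..j-1. c - real i) = real n * (real n - 1) / 2 * (c - (real n + 1) / 3)"
proof (induction n)
  case (Suc n)
  have row: "(\<Sum>i=1..n. c - real i) = real n * c - real n * (real n + 1) / 2" for n
    by (induction n) (auto simp: field_simps)
  have "(\<Sum>j=2..Suc n. \<Sum>i=1..j-1. c - real i) =
      (\<Sum>j=2..n. \<Sum>i=1..j-1. c - real i) + (\<Sum>i=1..n. c - real i)"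
    by (cases "n = 0") auto
  also have "\<dots> = real (Suc n) * (real (Suc n) - 1) / 2 * (c - (real (Suc n) + 1) / 3)"
    unfolding Suc.IH unfolding row by (simp add: field_simps)
  finally show ?case .
qed simp

definition dual_pivot_mean :: "nat \<Rightarrow> real" where
  "dual_pivot_mean n = 2 * (real n + 1) * harm n - 4 * real n"

text \<open>
  The leading term comes from summation by parts: the increment of
  \<open>n (n + 1) harm n\<close> is \<open>2 (n + 1) harm n + (n + 2)\<close>.
\<close>
lemma sum_dual_pivot_mean:
  "(\<Sum>k<n. dual_pivot_mean k) = real n * (real n + 1) * harm n - (5 * real n ^ 2 - real n) / 2"
proof (induction n)
  case (Suc n)
  have "(\<Sum>k<Suc n. dual_pivot_mean k) = (\<Sum>k<n. dual_pivot_mean k) + dual_pivot_mean n"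
    by simp
  also have "\<dots> = real (Suc n) * (real (Suc n) + 1) * harm (Suc n)
      - (5 * real (Suc n) ^ 2 - real (Suc n)) / 2"
    unfolding Suc.IH by (simp add: dual_pivot_mean_def harm_Suc field_simps power2_eq_square)
  finally show ?case .
qed simp

text \<open>
  Increasing \<open>n\<close> by one adds the plain sum to the weighted sum, so this is the second summation of
  the closed form.
\<close>
lemma weighted_sum_dual_pivot_mean:
  "(\<Sum>k<n. (real n - 1 - real k) * dual_pivot_mean k) =
     real n * (real n - 1) * (real n + 1) / 3 * harm n
       - real n * (real n - 1) * (17 * real n - 7) / 18"
proof (induction n)
  case (Suc n)
  have "(\<Sum>k<Suc n. (real (Suc n) - 1 - real k) * dual_pivot_mean k) =
      (\<Sum>k<n. (real n - 1 - real k) * dual_pivot_mean k) + (\<Sum>k<n. dual_pivot_mean k)"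
    by (simp add: algebra_simps flip: sum.distrib)
  also have "\<dots> = real (Suc n) * (real (Suc n) - 1) * (real (Suc n) + 1) / 3 * harm (Suc n)
      - real (Suc n) * (real (Suc n) - 1) * (17 * real (Suc n) - 7) / 18"
    unfolding Suc.IH sum_dual_pivot_mean
    by (simp add: harm_Suc field_simps power2_eq_square)
  finally show ?case .
qed simp

lemma dual_pivot_mean_rec:
  assumes "n \<ge> 2"
  shows "dual_pivot_mean n = 1 / real (n choose 2) *
    (\<Sum>j=2..n. \<Sum>i=1..j-1. dual_pivot_mean (i - 1) + dual_pivot_mean (j - i - 1)
       + dual_pivot_mean (n - j) + real (2 * n - i - 2))" (is "_ = _ * ?S")
proof -
  have choose: "real (n choose 2) = real n * (real n - 1) / 2"
    using assms by (simp add: choose_two real_of_nat_div of_nat_diff)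
  have pos: "real n * (real n - 1) / 2 \<noteq> 0"
    using assms by auto
  have cost: "(\<Sum>j=2..n. \<Sum>i=1..j-1. real (2 * n - i - 2)) =
      (\<Sum>j=2..n. \<Sum>i=1..j-1. (2 * real n - 2) - real i)"
    by (intro sum.cong refl) (auto simp: of_nat_diff)
  have "?S = 3 * (\<Sum>k<n. (real n - 1 - real k) * dual_pivot_mean k)
       + real n * (real n - 1) / 2 * ((2 * real n - 2) - (real n + 1) / 3)"
    by (simp only: sum.distrib sum_rank_pairs_left sum_rank_pairs_middle sum_rank_pairs_right
          cost sum_rank_pairs_cost)
  also have "\<dots> = real n * (real n - 1) / 2 * dual_pivot_mean n"
    unfolding weighted_sum_dual_pivot_mean by (simp add: dual_pivot_mean_def field_simps)
  finally have total: "?S = real n * (real n - 1) / 2 * dual_pivot_mean n" .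
  show ?thesis
    unfolding choose total using pos by simp
qed

text \<open>
  Termination needs the bounds on the summation indices, which the congruence rule for sums
  makes available at the recursive calls. The value \<open>t\<close> at \<open>n = 2\<close> is an instance of the
  recurrence: its only summand is \<open>t ^ (2 * 2 - 1 - 2)\<close>.
\<close>
function dual_pivot_pgf :: "real \<Rightarrow> nat \<Rightarrow> real" where
  "dual_pivot_pgf t n =
     (if n \<le> 1 then 1
      else 1 / real (n choose 2) *
        (\<Sum>j=2..n. \<Sum>i=1..j-1. dual_pivot_pgf t (i - 1) * dual_pivot_pgf t (j - i - 1) *
           dual_pivot_pgf t (n - j) * t ^ (2 * n - i - 2)))"
  by pat_completeness auto
termination
  by (relation "Wellfounded.measure snd") auto

declare dual_pivot_pgf.simps [simp del]

lemma expectation_power_dual_pivot_comparisons: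
  assumes "distinct xs"
  shows "measure_pmf.expectation (dual_pivot_comparisons xs) (\<lambda>c. t ^ c)
           = dual_pivot_pgf t (length xs)"
proof (rule dual_pivot_comparisons_pgf)
  have small: "dual_pivot_pgf t k = 1" if "k \<le> 1" for k
    using that by (simp add: dual_pivot_pgf.simps)
  then show "dual_pivot_pgf t 0 = 1" "dual_pivot_pgf t 1 = 1"
    by simp_all
  show "dual_pivot_pgf t 2 = t"
    by (subst dual_pivot_pgf.simps) (simp add: small)
  show "dual_pivot_pgf t n = 1 / real (n choose 2) *
      (\<Sum>j=2..n. \<Sum>i=1..j-1. dual_pivot_pgf t (i - 1) * dual_pivot_pgf t (j - i - 1) *
         dual_pivot_pgf t (n - j) * t ^ (2 * n - i - 2))" if "n \<ge> 3" for n
    using that by (subst dual_pivot_pgf.simps) simp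
qed fact

text \<open>
  A distinct list of length \<open>n\<close> exists, so this is the expectation of the constant \<open>1\<close>.
\<close>
lemma dual_pivot_pgf_at_1: "dual_pivot_pgf 1 n = 1"
  using expectation_power_dual_pivot_comparisons[of "[0..<n]" 1] by simp

text \<open>
  Since all factors are \<open>1\<close> at \<open>1\<close>, the recurrence for the generating functions differentiates
  to exactly the recurrence that the closed form satisfies.
\<close>
lemma has_real_derivative_dual_pivot_pgf:
  "((\<lambda>t. dual_pivot_pgf t n) has_real_derivative dual_pivot_mean n) (at 1)"
proof (induction n rule: less_induct)
  case (less n)
  show ?case
  proof (cases "n \<le> 1")
    case True
    then have "dual_pivot_mean n = 0"
      by (cases n) (auto simp: dual_pivot_mean_def harm_def)
    with True show ?thesis by (simp add: dual_pivot_pgf.simps)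
  next
    case False
    have summand: "((\<lambda>t. dual_pivot_pgf t (i - 1) * dual_pivot_pgf t (j - i - 1) *
        dual_pivot_pgf t (n - j) * t ^ (2 * n - i - 2)) has_real_derivative
        dual_pivot_mean (i - 1) + dual_pivot_mean (j - i - 1) + dual_pivot_mean (n - j)
          + real (2 * n - i - 2)) (at 1)"
      if "j \<in> {2..n}" "i \<in> {1..j-1}" for i j
      using that by (auto intro!: derivative_eq_intros less simp: dual_pivot_pgf_at_1)
    have "((\<lambda>t. 1 / real (n choose 2) *
        (\<Sum>j=2..n. \<Sum>i=1..j-1. dual_pivot_pgf t (i - 1) * dual_pivot_pgf t (j - i - 1) *
           dual_pivot_pgf t (n - j) * t ^ (2 * n - i - 2))) has_real_derivative
        1 / real (n choose 2) *
        (\<Sum>j=2..n. \<Sum>i=1..j-1. dual_pivot_mean (i - 1) + dual_pivot_mean (j - i - 1)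
           + dual_pivot_mean (n - j) + real (2 * n - i - 2))) (at 1)"
      by (intro DERIV_cmult DERIV_sum summand)
    then show ?thesis
      using False dual_pivot_mean_rec[of n] by (subst dual_pivot_pgf.simps) simp
  qed
qed

text \<open>Finite support makes the generating function a polynomial, to be differentiated termwise.\<close>
lemma has_real_derivative_pgf_at_1:
  fixes p :: "nat pmf"
  assumes "finite (set_pmf p)"
  shows "((\<lambda>t. measure_pmf.expectation p (\<lambda>c. t ^ c)) has_real_derivative
            measure_pmf.expectation p real) (at 1)"
proof -
  have expectation: "measure_pmf.expectation p f = (\<Sum>c\<in>set_pmf p. pmf p c * f c)"
    for f :: "nat \<Rightarrow> real"
    using integral_measure_pmf[OF assms, of p f] by simp
  show ?thesis
    unfolding expectation by (auto intro!: derivative_eq_intros sum.cong)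
qed

theorem theorem4p18:
  fixes n :: nat and xs :: "'a::linorder list"
  assumes "n \<ge> 1" and "distinct xs" and "length xs = n"
  shows "measure_pmf.expectation (dual_pivot_comparisons xs) real
           = 2 * (real n + 1) * harm n - 4 * real n"
proof -
  have "((\<lambda>t. dual_pivot_pgf t n) has_real_derivative
      measure_pmf.expectation (dual_pivot_comparisons xs) real) (at 1)"
    using has_real_derivative_pgf_at_1[of "dual_pivot_comparisons xs"] assms
    by (simp add: expectation_power_dual_pivot_comparisons)
  then show ?thesis
    using DERIV_unique[OF _ has_real_derivative_dual_pivot_pgf] by (simp add: dual_pivot_mean_def)
qed

end
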